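(* Let $\mathcal{P}=\{f_\lambda:\lambda\in\Lambda\}$ be a family of probability distributions, and let $\mathcal{L_G}$ be the underlying generalized likelihood function. Let $T=T(Y_1^n)$ be a generalized complete sufficient statistic for $\mathcal{P}$ (with respect to $\mathcal{L_G}$). Then every generalized estimable function $\widetilde{\tau}(\lambda)$ has one and only one generalized unbiased estimator that is of the form $h(T)$, for a fixed function $h$. Moreover, $h(T)$ is the unique generalized UMVUE of $\widetilde{\tau}(\lambda)$. (Uniqueness is understood up to equality with $\widetilde{P}_\lambda$-probability $1$ for all $\lambda\in\Lambda$.)
   Context: Setting: $\mathcal{P}=\{f_\lambda:\lambda\in\Lambda\}$, $\Lambda\subseteq\mathbb{R}^k$ open, is a parametric family of probability densities; $Y_1^n=(Y_1,\dots,Y_n)$ is an i.i.d. sample from some $f_\lambda$, with values $y_1^n\in S^n\subseteq\mathbb{R}^n$. A generalized likelihood function is a real-valued function $\mathcal{L_G}(y_1^n;\lambda)$ of the sample and the parameter (used in place of the log-likelihood). Deformed distribution: $\widetilde{f}_\lambda(y_1^n)=\dfrac{\exp[\mathcal{L_G}(y_1^n;\lambda)]}{\int \exp[\mathcal{L_G}(r_1^n;\lambda)]\,dr_1^n}$, where the denominator is assumed finite. $\widetilde{P}_\lambda,\widetilde{E}_\lambda,\widetilde{Var}_\lambda$ denote probability, expectation and variance when $Y_1^n$ has density $\widetilde{f}_\lambda$. A statistic $T$ (possibly vector valued) is generalized sufficient for $\mathcal{P}$ if $\mathcal{L_G}(r_1^n;\lambda)-\mathcal{L_G}(s_1^n;\lambda)$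 is independent of $\lambda$ whenever $T(r_1^n)=T(s_1^n)$. $T$ is generalized complete for $\mathcal{P}$ if for every function $h$, $\widetilde{E}_\lambda[h(T)]=0$ for all $\lambda\in\Lambda$ implies $\widetilde{P}_\lambda\{h(T)=0\}=1$ for all $\lambda\in\Lambda$. A generalized complete sufficient statistic is one that is both generalized sufficient and generalized complete. An estimator $\hat\lambda(Y_1^n)$ is a generalized unbiased estimator of $\widetilde{\tau}(\lambda)$ if $\widetilde{E}_\lambda[\hat\lambda(Y_1^n)]=\widetilde{\tau}(\lambda)$ for all $\lambda\in\Lambda$; $\widetilde{\tau}$ is then called a generalized estimable function. A generalized unbiased estimator $\hat\lambda$ of $\widetilde\tau(\lambda)$ is a generalized UMVUE (uniformly minimum variance unbiased estimator) if $\widetilde{Var}_\lambda(\hat\lambda)\le\widetilde{Var}_\lambda(\lambda^* )$ for all $\lambda\in\Lambda$ and every generalized unbiased estimator $\lambda^*$ of $\widetilde\tau(\lambda)$.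
   Formalization: Uniqueness of the generalized UMVUE is asserted only when h(T) has finite variance for at least one parameter; if its variance is infinite for every parameter, every generalized unbiased estimator is a UMVUE and uniqueness can fail. *)

theory Defs
  imports "HOL-Probability.Probability"
begin

definition sample_space :: "real set \<Rightarrow> (real ^ 'n) set" where
  "sample_space S = {y. \<forall>i. y $ i \<in> S}"

text \<open>Lebesgue measure on the sample space \<open>S^n\<close>, i.e. the meaning of \<open>dr_1^n\<close>.\<close>

abbreviation sample_lborel :: "real set \<Rightarrow> (real ^ 'n) measure" where
  "sample_lborel S \<equiv> restrict_space lborel (sample_space S)"

text \<open>
  The deformed distributions are built from \<open>L\<close> alone. The densities \<open>f\<close> of the original family
  enter only through the requirement that the observations take values in \<open>S\<close>.
\<close>

locale generalized_likelihood_model =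
  fixes S :: "real set"
    and \<Lambda> :: "(real ^ 'k) set"
    and f :: "real ^ 'k \<Rightarrow> real \<Rightarrow> real"
    and L :: "real ^ 'n \<Rightarrow> real ^ 'k \<Rightarrow> real"
  assumes open_parameters: "open \<Lambda>"
    and S_borel: "S \<in> sets borel"
    and f_measurable: "\<And>\<theta>. \<theta> \<in> \<Lambda> \<Longrightarrow> f \<theta> \<in> borel_measurable (restrict_space lborel S)"
    and f_nonneg: "\<And>\<theta> y. \<theta> \<in> \<Lambda> \<Longrightarrow> y \<in> S \<Longrightarrow> f \<theta> y \<ge> 0"
    and f_density: "\<And>\<theta>. \<theta> \<in> \<Lambda> \<Longrightarrow>
      prob_space (density (restrict_space lborel S) (\<lambda>y. ennreal (f \<theta> y)))"
    and L_measurable: "\<And>\<theta>. \<theta> \<in> \<Lambda> \<Longrightarrow> (\<lambda>y. L y \<theta>) \<in> borel_measurable (sample_lborel S)"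
    and finite_normalizer: "\<And>\<theta>. \<theta> \<in> \<Lambda> \<Longrightarrow>
      integrable (sample_lborel S) (\<lambda>r. exp (L r \<theta>))"

definition deformed ::
  "real set \<Rightarrow> (real ^ 'n \<Rightarrow> real ^ 'k \<Rightarrow> real) \<Rightarrow> real ^ 'k \<Rightarrow> (real ^ 'n) measure" where
  "deformed S L \<theta> = density (sample_lborel S)
     (\<lambda>y. ennreal (exp (L y \<theta>) / (LINT r|sample_lborel S. exp (L r \<theta>))))"

text \<open>
  The variance takes values in \<open>[0, \<infinity>]\<close>: with the Bochner integral, an estimator without second
  moment would get variance 0.
\<close>

definition gen_variance ::
  "real set \<Rightarrow> (real ^ 'n \<Rightarrow> real ^ 'k \<Rightarrow> real) \<Rightarrow> real ^ 'k \<Rightarrow> (real ^ 'n \<Rightarrow> real) \<Rightarrow> ennreal" where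
  "gen_variance S L \<theta> X =
     (\<integral>\<^sup>+ y. ennreal ((X y - (LINT z|deformed S L \<theta>. X z))\<^sup>2) \<partial>deformed S L \<theta>)"

definition generalized_sufficient ::
  "real set \<Rightarrow> (real ^ 'k) set \<Rightarrow> (real ^ 'n \<Rightarrow> real ^ 'k \<Rightarrow> real) \<Rightarrow> (real ^ 'n \<Rightarrow> 't) \<Rightarrow> bool" where
  "generalized_sufficient S \<Lambda> L T \<longleftrightarrow>
     (\<forall>r\<in>sample_space S. \<forall>s\<in>sample_space S. T r = T s \<longrightarrow>
        (\<forall>\<theta>\<in>\<Lambda>. \<forall>\<theta>'\<in>\<Lambda>. L r \<theta> - L s \<theta> = L r \<theta>' - L s \<theta>'))"

text \<open>
  The integrability condition says that the expectation of \<open>h(T)\<close> exists; it is needed because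
  the integral of a non-integrable function is 0 by convention.
\<close>

definition generalized_complete ::
  "real set \<Rightarrow> (real ^ 'k) set \<Rightarrow> (real ^ 'n \<Rightarrow> real ^ 'k \<Rightarrow> real) \<Rightarrow>
     (real ^ 'n \<Rightarrow> 't::euclidean_space) \<Rightarrow> bool" where
  "generalized_complete S \<Lambda> L T \<longleftrightarrow>
     (\<forall>h :: 't \<Rightarrow> real. h \<in> borel_measurable borel \<longrightarrow>
        (\<forall>\<theta>\<in>\<Lambda>. integrable (deformed S L \<theta>) (\<lambda>y. h (T y)) \<and>
               (LINT y|deformed S L \<theta>. h (T y)) = 0) \<longrightarrow>
        (\<forall>\<theta>\<in>\<Lambda>. \<P>(y in deformed S L \<theta>. h (T y) = 0) = 1))"

definition generalized_unbiased ::
  "real set \<Rightarrow> (real ^ 'k) set \<Rightarrow> (real ^ 'n \<Rightarrow> real ^ 'k \<Rightarrow> real) \<Rightarrow> (real ^ 'k \<Rightarrow> real) \<Rightarrow>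
     (real ^ 'n \<Rightarrow> real) \<Rightarrow> bool" where
  "generalized_unbiased S \<Lambda> L \<tau> X \<longleftrightarrow>
     X \<in> borel_measurable (sample_lborel S) \<and>
     (\<forall>\<theta>\<in>\<Lambda>. integrable (deformed S L \<theta>) X \<and> (LINT y|deformed S L \<theta>. X y) = \<tau> \<theta>)"

definition generalized_estimable ::
  "real set \<Rightarrow> (real ^ 'k) set \<Rightarrow> (real ^ 'n \<Rightarrow> real ^ 'k \<Rightarrow> real) \<Rightarrow> (real ^ 'k \<Rightarrow> real) \<Rightarrow> bool" where
  "generalized_estimable S \<Lambda> L \<tau> \<longleftrightarrow> (\<exists>X. generalized_unbiased S \<Lambda> L \<tau> X)"

text \<open>
  If every unbiased estimator has infinite variance at every parameter, then every unbiased
  estimator satisfies this definition; a UMVUE can only be unique when its variance is finite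
  for some parameter.
\<close>

definition generalized_UMVUE ::
  "real set \<Rightarrow> (real ^ 'k) set \<Rightarrow> (real ^ 'n \<Rightarrow> real ^ 'k \<Rightarrow> real) \<Rightarrow> (real ^ 'k \<Rightarrow> real) \<Rightarrow>
     (real ^ 'n \<Rightarrow> real) \<Rightarrow> bool" where
  "generalized_UMVUE S \<Lambda> L \<tau> X \<longleftrightarrow>
     generalized_unbiased S \<Lambda> L \<tau> X \<and>
     (\<forall>X'. generalized_unbiased S \<Lambda> L \<tau> X' \<longrightarrow>
        (\<forall>\<theta>\<in>\<Lambda>. gen_variance S L \<theta> X \<le> gen_variance S L \<theta> X'))"

definition deformed_as_equal ::
  "real set \<Rightarrow> (real ^ 'k) set \<Rightarrow> (real ^ 'n \<Rightarrow> real ^ 'k \<Rightarrow> real) \<Rightarrow>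
     (real ^ 'n \<Rightarrow> real) \<Rightarrow> (real ^ 'n \<Rightarrow> real) \<Rightarrow> bool" where
  "deformed_as_equal S \<Lambda> L X X' \<longleftrightarrow> (\<forall>\<theta>\<in>\<Lambda>. \<P>(y in deformed S L \<theta>. X y = X' y) = 1)"

end

theory Submission
  imports Defs
begin

text \<open>
  Up to normalization, the density ratio of two deformed laws is the exponential of a difference
  of likelihoods, which sufficiency makes constant on the fibres of \<open>T\<close>. A Borel function that is
  constant on the fibres of \<open>T\<close> is almost everywhere a Borel function of \<open>T\<close>, so one version
  \<open>h(T)\<close> of the conditional expectation of an unbiased estimator given \<open>T\<close> serves all parameters,
  and by Jensen's inequality it does not increase the variance. Completeness makes it independent
  of the estimator one started from, so it beats all of them.
\<close>

section \<open>Borel functions constant on the fibres of \<open>T\<close>\<close>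

text \<open>
  The graph of \<open>T\<close> over \<open>A\<close> is exhausted up to a null set by compact sets, whose projections to
  the range of \<open>T\<close> are again compact; this avoids the theory of analytic sets, needed to see that
  \<open>A\<close> itself belongs to the sigma-algebra generated by \<open>T\<close>.
\<close>

lemma factorise_saturated_set:
  fixes M :: "'a::polish_space measure" and T :: "'a \<Rightarrow> 'b::polish_space"
  assumes fin: "finite_measure M"
    and sets_M: "sets M = sets (restrict_space borel \<Omega>)" and \<Omega>: "\<Omega> \<in> sets borel"
    and T[measurable]: "T \<in> borel_measurable M"
    and A[measurable]: "A \<in> sets M"
    and sat: "\<And>x y. x \<in> A \<Longrightarrow> y \<in> space M \<Longrightarrow> T x = T y \<Longrightarrow> y \<in> A"
  shows "\<exists>B\<in>sets borel. AE x in M. x \<in> A \<longleftrightarrow> T x \<in> B"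
proof -
  interpret finite_measure M by fact
  have space_M: "space M = \<Omega>"
    using sets_eq_imp_space_eq[OF sets_M] by (simp add: space_restrict_space)
  have A_borel: "A \<in> sets borel" and A_sub: "A \<subseteq> \<Omega>"
    using A \<Omega> unfolding sets_M by (auto simp: sets_restrict_space)
  have id_M[measurable]: "(\<lambda>x. x) \<in> borel_measurable M"
    by (subst measurable_cong_sets[OF sets_M refl]) (rule measurable_restrict_space1, simp)
  \<comment> \<open>Extending \<open>T\<close> by a constant outside \<open>\<Omega>\<close> makes
    it Borel on the whole type, so that its graph over \<open>A\<close> is a Borel set of the Polish
    product.\<close>
  define T' where "T' x = (if x \<in> \<Omega> then T x else undefined)" for x
  have T'[measurable]: "T' \<in> borel_measurable borel"
  proof -
    have "T \<in> borel_measurable (restrict_space borel \<Omega>)"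
      using T measurable_cong_sets[OF sets_M refl] by blast
    then have "(\<lambda>x. if x \<in> \<Omega> then T x else undefined) \<in> borel_measurable borel"
      using \<Omega> by (subst measurable_If_restrict_space_iff) auto
    then show ?thesis unfolding T'_def .
  qed
  define N where "N = distr M (borel :: ('a \<times> 'b) measure) (\<lambda>x. (x, T x))"
  define G where "G = {p. fst p \<in> A \<and> T' (fst p) = snd p}"
  have pair[measurable]: "(\<lambda>x. (x, T x)) \<in> borel_measurable M"
    by (rule borel_measurable_Pair) measurable
  have G: "G \<in> sets borel"
  proof -
    have "Measurable.pred borel (\<lambda>p::'a \<times> 'b. fst p \<in> A \<and> T' (fst p) = snd p)"
    proof -
      have [measurable]: "fst \<in> borel_measurable (borel :: ('a \<times> 'b) measure)"
          "snd \<in> borel_measurable (borel :: ('a \<times> 'b) measure)"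
        by (auto intro!: borel_measurable_continuous_onI continuous_on_fst continuous_on_snd continuous_on_id)
      have [measurable]: "A \<in> sets borel" by fact
      \<comment> \<open>Equality of the two coordinates is written as vanishing of their distance, a
        Borel function.\<close>
      have "Measurable.pred borel (\<lambda>p::'a \<times> 'b. fst p \<in> A \<and> dist (T' (fst p)) (snd p) = 0)"
        by measurable
      then show ?thesis by simp
    qed
    then show ?thesis by (simp add: G_def pred_def)
  qed
  have N_G: "emeasure N G = emeasure M A"
  proof -
    have "(\<lambda>x. (x, T x)) -` G \<inter> space M = A"
      using A_sub by (auto simp: G_def T'_def space_M)
    then show ?thesis using G by (simp add: N_def emeasure_distr)
  qed
  have N_fin: "emeasure N (space N) \<noteq> \<infinity>"
    unfolding N_def by (simp add: emeasure_distr emeasure_eq_measure)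
  \<comment> \<open>\<open>N\<close> is the law of \<open>(x, T x)\<close>, a finite Borel measure
    on a Polish space, hence inner regular.\<close>
  have "emeasure N G = (SUP K\<in>{K. K \<subseteq> G \<and> compact K}. emeasure N K)"
    by (rule inner_regular) (use N_fin G in \<open>auto simp: N_def\<close>)
  moreover have "{K. K \<subseteq> G \<and> compact K} \<noteq> {}" by auto
  ultimately obtain F :: "nat \<Rightarrow> ennreal"
    where F: "range F \<subseteq> emeasure N ` {K. K \<subseteq> G \<and> compact K}" and F_Sup: "emeasure N G = (SUP n. F n)"
    using ennreal_SUP_countable_SUP[of "{K. K \<subseteq> G \<and> compact K}" "emeasure N"] by auto
  from F have "\<forall>n. \<exists>K. K \<subseteq> G \<and> compact K \<and> F n = emeasure N K" by auto
  then obtain K where K: "\<And>n. K n \<subseteq> G" "\<And>n. compact (K n)" "\<And>n. F n = emeasure N (K n)"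
    by metis
  define B where "B = (\<Union>n. snd ` K n)"
  have B[measurable]: "B \<in> sets borel"
  proof -
    have "compact (snd ` K n)" for n
      by (intro compact_continuous_image continuous_intros K)
    then show ?thesis unfolding B_def by (intro sets.countable_UN) (auto intro: borel_compact)
  qed
  let ?A = "T -` B \<inter> space M"
  have sub: "?A \<subseteq> A"
  proof
    fix y assume y: "y \<in> ?A"
    then obtain n x where "(x, T y) \<in> K n" by (auto simp: B_def)
    then have "(x, T y) \<in> G" using K by blast
    then have "x \<in> A" "T x = T y" using A_sub by (auto simp: G_def T'_def split: if_splits)
    then show "y \<in> A" using sat y by auto
  qed
  \<comment> \<open>A point whose graph point lies in \<open>K n\<close> has its
    \<open>T\<close>-value in \<open>B\<close>. So the mass of \<open>?A\<close> bounds every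
    \<open>emeasure N (K n)\<close>, hence also their supremum, which is the mass of
    \<open>A\<close>.\<close>
  have "emeasure N (K n) \<le> emeasure M ?A" for n
  proof -
    have "emeasure N (K n) = emeasure M ((\<lambda>x. (x, T x)) -` K n \<inter> space M)"
      unfolding N_def by (intro emeasure_distr pair) (simp add: K borel_compact)
    also have "\<dots> \<le> emeasure M ?A"
    proof (rule emeasure_mono)
      show "(\<lambda>x. (x, T x)) -` K n \<inter> space M \<subseteq> ?A"
        by (force simp: B_def)
    qed measurable
    finally show ?thesis .
  qed
  then have "emeasure M A \<le> emeasure M ?A"
    unfolding N_G[symmetric] F_Sup K(3) by (intro SUP_least)
  moreover have "emeasure M ?A \<le> emeasure M A" using sub by (intro emeasure_mono) auto
  ultimately have "emeasure M (A - ?A) = 0"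
    using sub by (subst emeasure_Diff) auto
  then have "AE x in M. x \<notin> A - ?A" 
    by (intro AE_not_in null_setsI) auto
  then have "AE x in M. x \<in> A \<longleftrightarrow> T x \<in> B"
    using AE_space by eventually_elim (use sub in auto)
  then show ?thesis using B by blast
qed

text \<open>The sublevel sets of \<open>X\<close> at rational levels are saturated, so each is
  almost everywhere the preimage under \<open>T\<close> of a Borel set \<open>B q\<close>. The value
  of \<open>X\<close> is recovered as the infimum of the rationals \<open>q\<close> with
  \<open>T x \<in> B q\<close>; there are countably many exceptional null sets.\<close>

lemma factorise_saturated_function:
  fixes M :: "'a::polish_space measure" and T :: "'a \<Rightarrow> 'b::polish_space" and X :: "'a \<Rightarrow> real"
  assumes fin: "finite_measure M"
    and sets_M: "sets M = sets (restrict_space borel \<Omega>)" and \<Omega>: "\<Omega> \<in> sets borel"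
    and T: "T \<in> borel_measurable M"
    and X[measurable]: "X \<in> borel_measurable M"
    and sat: "\<And>x y. x \<in> space M \<Longrightarrow> y \<in> space M \<Longrightarrow> T x = T y \<Longrightarrow> X x = X y"
  shows "\<exists>g\<in>borel_measurable borel. AE x in M. X x = g (T x)"
proof -
  have "\<exists>B\<in>sets borel. AE x in M. x \<in> {x\<in>space M. X x < real_of_rat q} \<longleftrightarrow> T x \<in> B" for q
  proof (rule factorise_saturated_set[OF fin sets_M \<Omega> T])
    fix x y assume "x \<in> {x \<in> space M. X x < real_of_rat q}" "y \<in> space M" "T x = T y"
    then show "y \<in> {x \<in> space M. X x < real_of_rat q}" using sat[of x y] by simp
  qed measurable
  then obtain B where B[measurable]: "\<And>q. B q \<in> sets borel"
    and B_AE: "\<And>q. AE x in M. x \<in> {x\<in>space M. X x < real_of_rat q} \<longleftrightarrow> T x \<in> B q"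
    by metis
  \<comment> \<open>The value \<infinity> removes the levels \<open>q\<close> with
    \<open>t \<notin> B q\<close> from the infimum. It is taken in the extended reals, where it
    always exists and stays Borel; an infinite infimum becomes 0.\<close>
  define g where "g t = real_of_ereal (INF q. if t \<in> B q then ereal (real_of_rat q) else \<infinity>)" for t
  have "g \<in> borel_measurable borel" unfolding g_def by measurable
  moreover have "AE x in M. \<forall>q. x \<in> {x\<in>space M. X x < real_of_rat q} \<longleftrightarrow> T x \<in> B q"
    using B_AE by (simp add: AE_all_countable)
  then have "AE x in M. X x = g (T x)"
    using AE_space
  proof eventually_elim
    case (elim x)
    have "(INF q. if T x \<in> B q then ereal (real_of_rat q) else \<infinity>) = ereal (X x)"
    proof (rule antisym)
      show "ereal (X x) \<le> (INF q. if T x \<in> B q then ereal (real_of_rat q) else \<infinity>)"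
        using elim by (intro INF_greatest) (auto intro: less_imp_le)
      show "(INF q. if T x \<in> B q then ereal (real_of_rat q) else \<infinity>) \<le> ereal (X x)"
      proof (rule ereal_le_epsilon2)
        fix e :: real assume "0 < e"
        then obtain q where q: "X x < real_of_rat q" "real_of_rat q < X x + e"
          using of_rat_dense[of "X x" "X x + e"] by auto
        have "(INF q. if T x \<in> B q then ereal (real_of_rat q) else \<infinity>) \<le> ereal (real_of_rat q)"
          using elim q by (intro INF_lower2[of q]) auto
        also have "\<dots> \<le> ereal (X x) + ereal e" using q by simp
        finally show "(INF q. if T x \<in> B q then ereal (real_of_rat q) else \<infinity>) \<le> ereal (X x) + ereal e" .
      qed
    qed
    then show ?case by (simp add: g_def)
  qed
  ultimately show ?thesis by blast
qed

section \<open>Auxiliary facts on measurability and convexity\<close>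

lemma sample_space_borel: "S \<in> sets borel \<Longrightarrow> (sample_space S :: (real ^ 'n) set) \<in> sets borel"
proof -
  assume [measurable]: "S \<in> sets borel"
  have [measurable]: "(\<lambda>y :: real ^ 'n. y $ i) \<in> borel_measurable borel" for i
    by (intro borel_measurable_continuous_onI continuous_intros)
  have "{y :: real ^ 'n. \<forall>i. y $ i \<in> S} \<in> sets borel"
    by measurable
  then show ?thesis by (simp add: sample_space_def)
qed

text \<open>The level set of \<open>c\<close> through \<open>x\<close> is a preimage under
  \<open>T\<close>, so it contains the whole fibre of \<open>x\<close>. This brings conditional
  expectations given \<open>T\<close> within reach of the factorisation above.\<close>

lemma measurable_vimage_algebra_fibres:
  fixes c :: "'a \<Rightarrow> real"
  assumes "c \<in> borel_measurable (vimage_algebra \<Omega> T N)" "T \<in> \<Omega> \<rightarrow> space N"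
    and "x \<in> \<Omega>" "y \<in> \<Omega>" "T x = T y"
  shows "c x = c y"
proof -
  have "c -` {c x} \<inter> \<Omega> \<in> sets (vimage_algebra \<Omega> T N)"
    using measurable_sets[OF assms(1), of "{c x}"] by simp
  then obtain B where "c -` {c x} \<inter> \<Omega> = T -` B \<inter> \<Omega>"
    unfolding sets_vimage_algebra2[OF assms(2)] by auto
  moreover from this have "x \<in> T -` B \<inter> \<Omega>" using assms(3) by blast
  ultimately have "y \<in> c -` {c x} \<inter> \<Omega>" using assms(4,5) by auto
  then show ?thesis by simp
qed

text \<open>This is the function for the conditional Jensen inequality, with \<open>c\<close> the
  common mean. Its convexity gap is exactly \<open>(1 - t) * t * (x - y)\<^sup>2\<close>.\<close>

lemma convex_on_power2_diff: "convex_on UNIV (\<lambda>x::real. (x - c)\<^sup>2)"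
proof (rule convex_onI)
  fix t x y :: real assume "0 < t" "t < 1"
  then have "0 \<le> (1 - t) * t * (x - y)\<^sup>2" by simp
  then show "((1 - t) *\<^sub>R x + t *\<^sub>R y - c)\<^sup>2 \<le> (1 - t) * (x - c)\<^sup>2 + t * (y - c)\<^sup>2"
  proof -
    have "(1 - t) * (x - c)\<^sup>2 + t * (y - c)\<^sup>2 - ((1 - t) * x + t * y - c)\<^sup>2 = (1 - t) * t * (x - y)\<^sup>2"
      by algebra
    with \<open>0 \<le> (1 - t) * t * (x - y)\<^sup>2\<close> show ?thesis by simp
  qed
qed simp

section \<open>Deformed laws and their densities\<close>

text \<open>The parameter \<open>\<theta>\<^sub>0\<close> singles out a reference law: densities are
  compared with its density, and conditional expectations are first formed under it.\<close>

locale complete_sufficient_model = generalized_likelihood_model S \<Lambda> f L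
  for S :: "real set" and \<Lambda> :: "(real ^ 'k) set" and f and L :: "real ^ 'n \<Rightarrow> real ^ 'k \<Rightarrow> real" +
  fixes T :: "real ^ 'n \<Rightarrow> 't::euclidean_space" and \<theta>\<^sub>0 :: "real ^ 'k"
  assumes T_measurable[measurable]: "T \<in> borel_measurable (sample_lborel S)"
    and sufficient: "generalized_sufficient S \<Lambda> L T"
    and complete: "generalized_complete S \<Lambda> L T"
    and base_parameter: "\<theta>\<^sub>0 \<in> \<Lambda>"
begin

abbreviation \<mu> :: "(real ^ 'n) measure" where "\<mu> \<equiv> sample_lborel S"

definition w :: "real ^ 'k \<Rightarrow> real ^ 'n \<Rightarrow> real" where
  "w \<theta> y = exp (L y \<theta>) / (LINT r|\<mu>. exp (L r \<theta>))"

text \<open>Conditioning on this sigma-algebra, generated by \<open>T\<close> on the sample space,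
  is conditioning on \<open>T\<close>.\<close>

definition F :: "(real ^ 'n) measure" where "F = vimage_algebra (sample_space S) T borel"

lemma deformed_density: "deformed S L \<theta> = density \<mu> (\<lambda>y. ennreal (w \<theta> y))"
  by (simp add: deformed_def w_def)

lemma space_deformed[simp]: "space (deformed S L \<theta>) = sample_space S"
  by (simp add: deformed_density space_restrict_space)

lemma sets_deformed[measurable_cong]: "sets (deformed S L \<theta>) = sets \<mu>"
  by (simp add: deformed_density)

lemma w_measurable[measurable]: "\<theta> \<in> \<Lambda> \<Longrightarrow> w \<theta> \<in> borel_measurable \<mu>"
  using L_measurable[of \<theta>] unfolding w_def by measurable

text \<open>
  Completeness applied to \<open>h = 0\<close> excludes the case that \<open>S^n\<close> is a null set, where the
  normalizer vanishes and \<open>deformed\<close> is the zero measure.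
\<close>

lemma prob_space_deformed: "\<theta> \<in> \<Lambda> \<Longrightarrow> prob_space (deformed S L \<theta>)"
proof -
  assume "\<theta> \<in> \<Lambda>"
  then have one: "measure (deformed S L \<theta>) (space (deformed S L \<theta>)) = 1"
    using complete[unfolded generalized_complete_def, rule_format, of "\<lambda>_. 0" \<theta>] by simp
  \<comment> \<open>\<open>measure\<close> sends infinite mass to 0, so the value 1 also rules out
    infinite mass.\<close>
  then have "emeasure (deformed S L \<theta>) (space (deformed S L \<theta>)) \<noteq> \<top>"
    by (auto dest: measure_zero_top)
  from emeasure_eq_ennreal_measure[OF this] show ?thesis
    unfolding one by (intro prob_spaceI) simp
qed

text \<open>Division by zero yields 0, so a vanishing normalizer would make the density identically
  zero, against total mass 1.\<close>

lemma w_pos: assumes "\<theta> \<in> \<Lambda>" shows "0 < w \<theta> y"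
proof -
  interpret prob_space "deformed S L \<theta>" using assms by (rule prob_space_deformed)
  have "(LINT r|\<mu>. exp (L r \<theta>)) \<noteq> 0"
  proof
    assume "(LINT r|\<mu>. exp (L r \<theta>)) = 0"
    then have "emeasure (deformed S L \<theta>) (space (deformed S L \<theta>)) = 0"
      by (simp add: deformed_density w_def emeasure_density)
    then show False using emeasure_space_1 by simp
  qed
  moreover have "(LINT r|\<mu>. exp (L r \<theta>)) \<ge> 0" by simp
  ultimately have "(LINT r|\<mu>. exp (L r \<theta>)) > 0" by linarith
  then show ?thesis unfolding w_def by (intro divide_pos_pos exp_gt_zero)
qed

text \<open>As the density is strictly positive, every deformed law has the null sets of
  \<open>\<mu>\<close>. Almost sure statements can thus be moved freely between parameters.\<close>

lemma AE_deformed: "\<theta> \<in> \<Lambda> \<Longrightarrow> (AE y in deformed S L \<theta>. Q y) \<longleftrightarrow> (AE y in \<mu>. Q y)"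
  unfolding deformed_density by (subst AE_density) (auto simp: w_pos)

lemma integrable_deformed:
  fixes X :: "real ^ 'n \<Rightarrow> real"
  assumes "\<theta> \<in> \<Lambda>" "X \<in> borel_measurable \<mu>"
  shows "integrable (deformed S L \<theta>) X \<longleftrightarrow> integrable \<mu> (\<lambda>y. w \<theta> y * X y)"
  unfolding deformed_density
  using assms w_pos[OF assms(1)] by (subst integrable_density) (auto intro!: AE_I2 less_imp_le)

lemma integral_deformed:
  fixes X :: "real ^ 'n \<Rightarrow> real"
  assumes "\<theta> \<in> \<Lambda>" "X \<in> borel_measurable \<mu>"
  shows "(LINT y|deformed S L \<theta>. X y) = (LINT y|\<mu>. w \<theta> y * X y)"
  unfolding deformed_density
  using assms w_pos[OF assms(1)] by (subst integral_density) (auto intro!: AE_I2 less_imp_le)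

section \<open>Consequences of sufficiency for the densities\<close>

text \<open>The factorisation requires a finite measure, while \<open>\<mu>\<close> may be infinite;
  it is applied to the law at \<open>\<theta>\<^sub>0\<close>, which has the same null sets.\<close>

lemma function_of_T:
  fixes X :: "real ^ 'n \<Rightarrow> real"
  assumes "X \<in> borel_measurable \<mu>"
    and "\<And>x y. x \<in> sample_space S \<Longrightarrow> y \<in> sample_space S \<Longrightarrow> T x = T y \<Longrightarrow> X x = X y"
  shows "\<exists>g\<in>borel_measurable borel. AE y in \<mu>. X y = g (T y)"
proof -
  interpret prob_space "deformed S L \<theta>\<^sub>0" using base_parameter by (rule prob_space_deformed)
  have "\<exists>g\<in>borel_measurable borel. AE y in deformed S L \<theta>\<^sub>0. X y = g (T y)"
  proof (rule factorise_saturated_function)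
    show "sets (deformed S L \<theta>\<^sub>0) = sets (restrict_space borel (sample_space S))"
      unfolding sets_deformed by (rule sets_restrict_space_cong) simp
    show "X \<in> borel_measurable (deformed S L \<theta>\<^sub>0)" using assms(1) by measurable
    show "T \<in> borel_measurable (deformed S L \<theta>\<^sub>0)" by measurable
    show "X x = X y"
      if "x \<in> space (deformed S L \<theta>\<^sub>0)" "y \<in> space (deformed S L \<theta>\<^sub>0)" "T x = T y" for x y
      using that assms(2) unfolding space_deformed by blast
  qed (rule sample_space_borel S_borel finite_measure_axioms)+
  then show ?thesis by (simp add: AE_deformed base_parameter)
qed

text \<open>A Fisher-Neyman factorisation relative to \<open>\<theta>\<^sub>0\<close>: sufficiency
  makes \<open>L y \<theta> - L y \<theta>\<^sub>0\<close> constant on the fibres of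
  \<open>T\<close>, and the quotient of the normalizers does not depend on the sample.\<close>

lemma density_ratio_function_of_T:
  assumes "\<theta> \<in> \<Lambda>"
  shows "\<exists>r\<in>borel_measurable borel. AE y in \<mu>. w \<theta> y = w \<theta>\<^sub>0 y * r (T y)"
proof -
  have [measurable]: "w \<theta> \<in> borel_measurable \<mu>" "w \<theta>\<^sub>0 \<in> borel_measurable \<mu>"
    using assms base_parameter by auto
  have "\<exists>r\<in>borel_measurable borel. AE y in \<mu>. w \<theta> y / w \<theta>\<^sub>0 y = r (T y)"
  proof (rule function_of_T)
    fix x y assume "x \<in> sample_space S" "y \<in> sample_space S" "T x = T y"
    then have "L x \<theta> - L y \<theta> = L x \<theta>\<^sub>0 - L y \<theta>\<^sub>0"
      using sufficient assms base_parameter unfolding generalized_sufficient_def by blast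
    then have "L x \<theta> - L x \<theta>\<^sub>0 = L y \<theta> - L y \<theta>\<^sub>0" by simp
    then have "exp (L x \<theta>) / exp (L x \<theta>\<^sub>0) = exp (L y \<theta>) / exp (L y \<theta>\<^sub>0)"
      by (simp flip: exp_diff)
    moreover have "w \<theta> z / w \<theta>\<^sub>0 z = (exp (L z \<theta>) / exp (L z \<theta>\<^sub>0)) *
        ((LINT r|\<mu>. exp (L r \<theta>\<^sub>0)) / (LINT r|\<mu>. exp (L r \<theta>)))" for z
      by (simp add: w_def)
    ultimately show "w \<theta> x / w \<theta>\<^sub>0 x = w \<theta> y / w \<theta>\<^sub>0 y" by presburger
  qed measurable
  then obtain r where "r \<in> borel_measurable borel" "AE y in \<mu>. w \<theta> y / w \<theta>\<^sub>0 y = r (T y)" by blast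
  moreover from this(2) have "AE y in \<mu>. w \<theta> y = w \<theta>\<^sub>0 y * r (T y)"
  proof eventually_elim
    case (elim y)
    then show ?case using w_pos[OF base_parameter, of y] by (simp flip: elim)
  qed
  ultimately show ?thesis by blast
qed

section \<open>Conditional expectation given \<open>T\<close>\<close>

lemma T_F[measurable]: "T \<in> borel_measurable F"
  unfolding F_def by (rule measurable_vimage_algebra1) simp

lemma subalgebra_F: "subalgebra (deformed S L \<theta>) F"
proof -
  have "sets F \<subseteq> sets \<mu>"
    unfolding F_def by (subst sets_vimage_algebra2)
      (use measurable_sets[OF T_measurable] in \<open>auto simp: space_restrict_space\<close>)
  then show ?thesis
    by (simp add: subalgebra_def sets_deformed) (simp add: F_def)
qed

lemma F_measurable_\<mu>: "X \<in> borel_measurable F \<Longrightarrow> X \<in> borel_measurable \<mu>"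
  using measurable_from_subalg[OF subalgebra_F] measurable_cong_sets[OF sets_deformed refl] by blast

lemma finite_measure_subalgebra_F:
  assumes "\<theta> \<in> \<Lambda>" shows "finite_measure_subalgebra (deformed S L \<theta>) F"
proof -
  interpret prob_space "deformed S L \<theta>" using assms by (rule prob_space_deformed)
  show ?thesis by unfold_locales (rule subalgebra_F)
qed

text \<open>
  By sufficiency the density of each deformed law with respect to the one at \<open>\<theta>\<^sub>0\<close> is a function
  of \<open>T\<close>, so the conditional expectation given \<open>T\<close> does not depend on the parameter.
\<close>

lemma cond_exp_parameter_free:
  fixes X :: "real ^ 'n \<Rightarrow> real"
  assumes X[measurable]: "X \<in> borel_measurable \<mu>"
    and X_int: "\<And>\<theta>. \<theta> \<in> \<Lambda> \<Longrightarrow> integrable (deformed S L \<theta>) X"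
  shows "\<exists>h\<in>borel_measurable borel. \<forall>\<theta>\<in>\<Lambda>. AE y in \<mu>. real_cond_exp (deformed S L \<theta>) F X y = h (T y)"
proof -
  let ?P = "deformed S L \<theta>\<^sub>0"
  interpret P: finite_measure_subalgebra ?P F
    using base_parameter by (rule finite_measure_subalgebra_F)
  define c where "c = real_cond_exp ?P F X"
  have c_F: "c \<in> borel_measurable F" unfolding c_def by simp
  have c[measurable]: "c \<in> borel_measurable \<mu>" using c_F by (rule F_measurable_\<mu>)
  have X_P: "X \<in> borel_measurable ?P" by measurable
  have "\<exists>h\<in>borel_measurable borel. AE y in \<mu>. c y = h (T y)"
    by (rule function_of_T[OF c], rule measurable_vimage_algebra_fibres[OF c_F[unfolded F_def]]) auto
  then obtain h where h[measurable]: "h \<in> borel_measurable borel" and ch: "AE y in \<mu>. c y = h (T y)"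
    by blast
  have "AE y in \<mu>. real_cond_exp (deformed S L \<theta>) F X y = h (T y)" if \<theta>: "\<theta> \<in> \<Lambda>" for \<theta>
  proof -
    let ?Q = "deformed S L \<theta>"
    interpret Q: finite_measure_subalgebra ?Q F using \<theta> by (rule finite_measure_subalgebra_F)
    obtain r where r[measurable]: "r \<in> borel_measurable borel"
      and wr: "AE y in \<mu>. w \<theta> y = w \<theta>\<^sub>0 y * r (T y)"
      using density_ratio_function_of_T[OF \<theta>] by blast
    have [measurable]: "w \<theta> \<in> borel_measurable \<mu>" "w \<theta>\<^sub>0 \<in> borel_measurable \<mu>"
      using \<theta> base_parameter by auto
    \<comment> \<open>Changing from \<open>?Q\<close> to \<open>?P\<close> multiplies the test
      function by \<open>r (T y)\<close>, which keeps it \<open>F\<close>-measurable. Under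
      \<open>?P\<close> the estimator may then be replaced by \<open>c\<close>, which is almost
      everywhere \<open>h (T y)\<close>, and the change of measure is undone.\<close>
    have key: "integrable ?Q (\<lambda>y. \<phi> y * h (T y)) \<and>
        (LINT y|?Q. \<phi> y * h (T y)) = (LINT y|?Q. \<phi> y * X y)"
      if \<phi>: "\<phi> \<in> borel_measurable F" and int: "integrable ?Q (\<lambda>y. \<phi> y * X y)" for \<phi> :: "real ^ 'n \<Rightarrow> real"
    proof -
      have [measurable]: "\<phi> \<in> borel_measurable \<mu>" using \<phi> by (rule F_measurable_\<mu>)
      have \<phi>r: "(\<lambda>y. \<phi> y * r (T y)) \<in> borel_measurable F" using \<phi> by measurable
      have change: "AE y in \<mu>. w \<theta>\<^sub>0 y * (\<phi> y * r (T y) * Z y) = w \<theta> y * (\<phi> y * Z' y)"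
        if "AE y in \<mu>. Z y = Z' y" for Z Z' :: "real ^ 'n \<Rightarrow> real"
        using that wr by eventually_elim simp
      have "integrable \<mu> (\<lambda>y. w \<theta> y * (\<phi> y * X y))"
        using int by (subst (asm) integrable_deformed[OF \<theta>]) auto
      then have "integrable \<mu> (\<lambda>y. w \<theta>\<^sub>0 y * (\<phi> y * r (T y) * X y))"
        by (subst integrable_cong_AE[OF _ _ change[of X X]]) auto
      then have int0: "integrable ?P (\<lambda>y. \<phi> y * r (T y) * X y)"
        by (subst integrable_deformed[OF base_parameter]) auto
      note E = P.real_cond_exp_intg[OF int0 \<phi>r X_P, folded c_def]
      have "integrable \<mu> (\<lambda>y. w \<theta>\<^sub>0 y * (\<phi> y * r (T y) * c y))"
        using E(1) by (subst (asm) integrable_deformed[OF base_parameter]) auto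
      then have "integrable \<mu> (\<lambda>y. w \<theta> y * (\<phi> y * h (T y)))"
        by (subst (asm) integrable_cong_AE[OF _ _ change[OF ch]]) auto
      then have "integrable ?Q (\<lambda>y. \<phi> y * h (T y))"
        by (subst integrable_deformed[OF \<theta>]) auto
      moreover have "(LINT y|?Q. \<phi> y * h (T y)) = (LINT y|\<mu>. w \<theta> y * (\<phi> y * h (T y)))"
        by (intro integral_deformed \<theta>) auto
      moreover have "\<dots> = (LINT y|\<mu>. w \<theta>\<^sub>0 y * (\<phi> y * r (T y) * c y))"
        by (rule integral_cong_AE[OF _ _ change[OF ch], symmetric]) auto
      moreover have "\<dots> = (LINT y|?P. \<phi> y * r (T y) * c y)"
        by (intro integral_deformed[symmetric] base_parameter) auto
      moreover have "\<dots> = (LINT y|?P. \<phi> y * r (T y) * X y)" by (rule E(2))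
      moreover have "\<dots> = (LINT y|\<mu>. w \<theta>\<^sub>0 y * (\<phi> y * r (T y) * X y))"
        by (intro integral_deformed base_parameter) auto
      moreover have "\<dots> = (LINT y|\<mu>. w \<theta> y * (\<phi> y * X y))"
        by (rule integral_cong_AE[OF _ _ change]) auto
      moreover have "\<dots> = (LINT y|?Q. \<phi> y * X y)"
        by (intro integral_deformed[symmetric] \<theta>) auto
      ultimately show ?thesis by simp
    qed
    have "AE y in ?Q. real_cond_exp ?Q F X y = h (T y)"
    proof (rule Q.real_cond_exp_charact)
      show "integrable ?Q X" using X_int[OF \<theta>] .
      \<comment> \<open>The constant test function 1 gives integrability; indicators of sets of
        \<open>F\<close> give the defining property of the conditional expectation below.\<close>
      show "integrable ?Q (\<lambda>y. h (T y))" using key[of "\<lambda>_. 1"] X_int[OF \<theta>] by simp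
      show "(\<lambda>y. h (T y)) \<in> borel_measurable F" by measurable
      fix A assume A: "A \<in> sets F"
      then have "A \<in> sets ?Q" using subalgebra_F[of \<theta>] by (auto simp: subalgebra_def)
      then have "integrable ?Q (\<lambda>y. indicator A y * X y)"
        using integrable_mult_indicator[OF _ X_int[OF \<theta>]] by simp
      then show "(LINT y:A|?Q. X y) = (LINT y:A|?Q. h (T y))"
        using key[of "indicator A"] A by (simp add: set_lebesgue_integral_def)
    qed
    then show ?thesis by (simp add: AE_deformed \<theta>)
  qed
  then show ?thesis using h by blast
qed

section \<open>Variance reduction by conditioning\<close>

text \<open>All unbiased estimators have the same centre \<open>\<tau> \<theta>\<close>, so
  comparing variances means comparing mean squared deviations from one constant.\<close>

lemma gen_variance_unbiased:
  "generalized_unbiased S \<Lambda> L \<tau> X \<Longrightarrow> \<theta> \<in> \<Lambda> \<Longrightarrow>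
    gen_variance S L \<theta> X = (\<integral>\<^sup>+ y. ennreal ((X y - \<tau> \<theta>)\<^sup>2) \<partial>deformed S L \<theta>)"
  by (simp add: gen_variance_def generalized_unbiased_def)

lemma unbiased_measurable:
  "generalized_unbiased S \<Lambda> L \<tau> X \<Longrightarrow> X \<in> borel_measurable (deformed S L \<theta>)"
  by (simp add: generalized_unbiased_def measurable_cong_sets[OF sets_deformed refl])

lemma square_integrable_iff_finite_variance:
  assumes "generalized_unbiased S \<Lambda> L \<tau> X" "\<theta> \<in> \<Lambda>"
  shows "integrable (deformed S L \<theta>) (\<lambda>y. (X y - \<tau> \<theta>)\<^sup>2) \<longleftrightarrow> gen_variance S L \<theta> X < \<infinity>"
  using unbiased_measurable[OF assms(1), of \<theta>]
  by (simp add: gen_variance_unbiased[OF assms] integrable_iff_bounded)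

lemma gen_variance_eq_integral:
  assumes "generalized_unbiased S \<Lambda> L \<tau> X" "\<theta> \<in> \<Lambda>" "gen_variance S L \<theta> X < \<infinity>"
  shows "gen_variance S L \<theta> X = ennreal (LINT y|deformed S L \<theta>. (X y - \<tau> \<theta>)\<^sup>2)"
  using assms square_integrable_iff_finite_variance[OF assms(1,2)]
  by (simp add: gen_variance_unbiased nn_integral_eq_integral)

text \<open>Conditioning on \<open>T\<close> preserves the mean by the tower property and does not
  increase the mean squared deviation from \<open>\<tau> \<theta>\<close> by the conditional Jensen
  inequality. A single \<open>h\<close> works for all parameters by
  \<open>cond_exp_parameter_free\<close>.\<close>

lemma rao_blackwell:
  assumes X: "generalized_unbiased S \<Lambda> L \<tau> X"
  shows "\<exists>h\<in>borel_measurable borel. generalized_unbiased S \<Lambda> L \<tau> (\<lambda>y. h (T y)) \<and>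
    (\<forall>\<theta>\<in>\<Lambda>. gen_variance S L \<theta> (\<lambda>y. h (T y)) \<le> gen_variance S L \<theta> X)"
proof -
  have X_meas[measurable]: "X \<in> borel_measurable \<mu>"
    and X_int: "\<And>\<theta>. \<theta> \<in> \<Lambda> \<Longrightarrow> integrable (deformed S L \<theta>) X"
    and X_mean: "\<And>\<theta>. \<theta> \<in> \<Lambda> \<Longrightarrow> (LINT y|deformed S L \<theta>. X y) = \<tau> \<theta>"
    using X by (auto simp: generalized_unbiased_def)
  obtain h where h[measurable]: "h \<in> borel_measurable borel"
    and ce: "\<And>\<theta>. \<theta> \<in> \<Lambda> \<Longrightarrow> AE y in \<mu>. real_cond_exp (deformed S L \<theta>) F X y = h (T y)"
    using cond_exp_parameter_free[OF X_meas X_int] by blast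
  have *: "integrable (deformed S L \<theta>) (\<lambda>y. h (T y)) \<and> (LINT y|deformed S L \<theta>. h (T y)) = \<tau> \<theta> \<and>
      (\<integral>\<^sup>+ y. ennreal ((h (T y) - \<tau> \<theta>)\<^sup>2) \<partial>deformed S L \<theta>) \<le> gen_variance S L \<theta> X"
    if \<theta>: "\<theta> \<in> \<Lambda>" for \<theta>
  proof -
    let ?Q = "deformed S L \<theta>" and ?E = "real_cond_exp (deformed S L \<theta>) F X"
    interpret Q: finite_measure_subalgebra ?Q F using \<theta> by (rule finite_measure_subalgebra_F)
    have ce: "AE y in ?Q. ?E y = h (T y)" using ce[OF \<theta>] by (simp add: AE_deformed \<theta>)
    have [measurable]: "?E \<in> borel_measurable ?Q" by simp
    have "integrable ?Q (\<lambda>y. h (T y))"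
      using Q.real_cond_exp_int(1)[OF X_int[OF \<theta>]] by (subst integrable_cong_AE[symmetric, OF _ _ ce]) auto
    moreover have "(LINT y|?Q. h (T y)) = \<tau> \<theta>"
      using Q.real_cond_exp_int(2)[OF X_int[OF \<theta>]] X_mean[OF \<theta>] integral_cong_AE[OF _ _ ce] by simp
    moreover have "(\<integral>\<^sup>+ y. ennreal ((h (T y) - \<tau> \<theta>)\<^sup>2) \<partial>?Q) \<le> gen_variance S L \<theta> X"
    \<comment> \<open>Finite variance supplies the integrability needed for the Jensen inequality;
      for infinite variance the bound is trivial.\<close>
    proof (cases "gen_variance S L \<theta> X < \<infinity>")
      case True
      let ?q = "\<lambda>x. (x - \<tau> \<theta>)\<^sup>2"
      have q: "integrable ?Q (\<lambda>y. ?q (X y))"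
        using True square_integrable_iff_finite_variance[OF X \<theta>] by simp
      note jensen = Q.real_cond_exp_jensens_inequality(2)[where I = UNIV, OF X_int[OF \<theta>] _ _ q convex_on_power2_diff]
      have qE: "integrable ?Q (\<lambda>y. ?q (?E y))"
        by (rule Q.integrable_convex_cond_exp[where I = UNIV, OF X_int[OF \<theta>] _ _ q convex_on_power2_diff]) auto
      have "(\<integral>\<^sup>+ y. ennreal (?q (h (T y))) \<partial>?Q) = (\<integral>\<^sup>+ y. ennreal (?q (?E y)) \<partial>?Q)"
        using ce by (intro nn_integral_cong_AE) auto
      also have "\<dots> = ennreal (LINT y|?Q. ?q (?E y))"
        using qE by (intro nn_integral_eq_integral) auto
      also have "\<dots> \<le> ennreal (LINT y|?Q. real_cond_exp ?Q F (\<lambda>y. ?q (X y)) y)"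
        by (intro ennreal_leI integral_mono_AE qE Q.real_cond_exp_int(1)[OF q] jensen) auto
      also have "\<dots> = ennreal (LINT y|?Q. ?q (X y))" using Q.real_cond_exp_int(2)[OF q] by simp
      also have "\<dots> = gen_variance S L \<theta> X" using gen_variance_eq_integral[OF X \<theta> True] by simp
      finally show ?thesis .
    qed (simp add: not_less top_unique)
    ultimately show ?thesis by blast
  qed
  then have hU: "generalized_unbiased S \<Lambda> L \<tau> (\<lambda>y. h (T y))"
    by (simp add: generalized_unbiased_def)
  then show ?thesis using * h by (auto simp: gen_variance_unbiased[OF hU])
qed

section \<open>Uniqueness and optimality\<close>

text \<open>Measurability of both estimators makes their equality an event, so probability 1 means
  almost sure equality, and the laws share the null sets of \<open>\<mu>\<close>.\<close>

lemma deformed_as_equal_iff: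
  assumes X: "generalized_unbiased S \<Lambda> L \<tau> X" and Y: "generalized_unbiased S \<Lambda> L \<tau>' Y"
  shows "deformed_as_equal S \<Lambda> L X Y \<longleftrightarrow> (AE y in \<mu>. X y = Y y)"
proof -
  have "\<P>(y in deformed S L \<theta>. X y = Y y) = 1 \<longleftrightarrow> (AE y in \<mu>. X y = Y y)" if \<theta>: "\<theta> \<in> \<Lambda>" for \<theta>
  proof -
    interpret prob_space "deformed S L \<theta>" using \<theta> by (rule prob_space_deformed)
    have "{y \<in> space (deformed S L \<theta>). X y = Y y} \<in> events"
      using unbiased_measurable[OF X, of \<theta>] unbiased_measurable[OF Y, of \<theta>] by measurable
    then show ?thesis by (simp add: prob_Collect_eq_1 AE_deformed \<theta> del: space_deformed)
  qed
  then show ?thesis using base_parameter by (auto simp: deformed_as_equal_def)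
qed

lemma unbiased_functions_of_T_unique:
  assumes h: "generalized_unbiased S \<Lambda> L \<tau> (\<lambda>y. h (T y))"
    and h': "generalized_unbiased S \<Lambda> L \<tau> (\<lambda>y. h' (T y))"
  shows "AE y in \<mu>. h (T y) = h' (T y)"
proof -
  \<comment> \<open>Only the compositions with \<open>T\<close> are known to be measurable, not
    \<open>h\<close> and \<open>h'\<close> themselves. Completeness speaks of Borel functions, so
    the difference is first replaced by a Borel function \<open>g\<close> of
    \<open>T\<close>.\<close>
  have "\<exists>g\<in>borel_measurable borel. AE y in \<mu>. h (T y) - h' (T y) = g (T y)"
    using h h' by (intro function_of_T) (auto simp: generalized_unbiased_def)
  then obtain g where g[measurable]: "g \<in> borel_measurable borel"
    and eq: "AE y in \<mu>. h (T y) - h' (T y) = g (T y)" by blast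
  have "integrable (deformed S L \<theta>) (\<lambda>y. g (T y)) \<and> (LINT y|deformed S L \<theta>. g (T y)) = 0"
    if \<theta>: "\<theta> \<in> \<Lambda>" for \<theta>
  proof -
    let ?Q = "deformed S L \<theta>"
    have ints: "integrable ?Q (\<lambda>y. h (T y))" "integrable ?Q (\<lambda>y. h' (T y))"
      "(LINT y|?Q. h (T y)) = (LINT y|?Q. h' (T y))"
      using h h' \<theta> by (auto simp: generalized_unbiased_def)
    have eq': "AE y in ?Q. h (T y) - h' (T y) = g (T y)" using eq by (simp add: AE_deformed \<theta>)
    have diff: "integrable ?Q (\<lambda>y. h (T y) - h' (T y))" using ints by simp
    have "integrable ?Q (\<lambda>y. g (T y))"
      using diff by (subst integrable_cong_AE[symmetric, OF _ _ eq']) auto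
    moreover have "(LINT y|?Q. g (T y)) = (LINT y|?Q. h (T y) - h' (T y))"
      using diff by (intro integral_cong_AE[OF _ _ eq', symmetric]) auto
    ultimately show ?thesis using ints by simp
  qed
  then have "\<P>(y in deformed S L \<theta>\<^sub>0. g (T y) = 0) = 1"
    using complete g base_parameter unfolding generalized_complete_def by blast
  moreover interpret prob_space "deformed S L \<theta>\<^sub>0" using base_parameter by (rule prob_space_deformed)
  have "{y \<in> space (deformed S L \<theta>\<^sub>0). g (T y) = 0} \<in> events" by measurable
  ultimately have "AE y in \<mu>. g (T y) = 0"
    using prob_Collect_eq_1 by (simp add: AE_deformed base_parameter del: space_deformed)
  with eq show ?thesis by eventually_elim simp
qed

text \<open>
  If two unbiased estimators both attain the minimal variance at one parameter, the
  parallelogram identity applied to their average bounds the mean square of their difference by 0.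
\<close>

lemma UMVUE_unique:
  assumes Y: "generalized_UMVUE S \<Lambda> L \<tau> Y" and X: "generalized_UMVUE S \<Lambda> L \<tau> X"
    and \<theta>: "\<theta> \<in> \<Lambda>" and fin: "gen_variance S L \<theta> Y < \<infinity>"
  shows "AE y in \<mu>. X y = Y y"
proof -
  let ?Q = "deformed S L \<theta>"
  let ?W = "\<lambda>y. (X y + Y y) / 2"
  have XU: "generalized_unbiased S \<Lambda> L \<tau> X" and YU: "generalized_unbiased S \<Lambda> L \<tau> Y"
    using X Y by (auto simp: generalized_UMVUE_def)
  have WU: "generalized_unbiased S \<Lambda> L \<tau> ?W"
    using XU YU by (auto simp: generalized_unbiased_def)
  have [measurable]: "X \<in> borel_measurable ?Q" "Y \<in> borel_measurable ?Q"
    using XU YU by (auto intro: unbiased_measurable)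
  have XY: "gen_variance S L \<theta> X \<le> gen_variance S L \<theta> Y"
    and YW: "gen_variance S L \<theta> Y \<le> gen_variance S L \<theta> ?W"
    using X Y XU YU WU \<theta> by (auto simp: generalized_UMVUE_def)
  have Xfin: "gen_variance S L \<theta> X < \<infinity>" using XY fin by (rule le_less_trans)
  let ?a = "\<lambda>y. (X y - \<tau> \<theta>)\<^sup>2" and ?b = "\<lambda>y. (Y y - \<tau> \<theta>)\<^sup>2" and ?c = "\<lambda>y. (?W y - \<tau> \<theta>)\<^sup>2"
  have a: "integrable ?Q ?a" and b: "integrable ?Q ?b"
    using square_integrable_iff_finite_variance[OF XU \<theta>] square_integrable_iff_finite_variance[OF YU \<theta>]
      fin Xfin by auto
  have parallelogram: "?c y = (?a y + ?b y) / 2 - (X y - Y y)\<^sup>2 / 4" for y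
    by (simp add: power2_eq_square field_simps)
  \<comment> \<open>By the parallelogram identity \<open>?c\<close> is dominated by the average of
    \<open>?a\<close> and \<open>?b\<close>.\<close>
  have c: "integrable ?Q ?c"
  proof (rule Bochner_Integration.integrable_bound)
    show "integrable ?Q (\<lambda>y. (?a y + ?b y) / 2)" using a b by simp
    have "norm (?c y) \<le> norm ((?a y + ?b y) / 2)" for y
    proof -
      have "0 \<le> ?c y" by simp
      moreover have "?c y \<le> (?a y + ?b y) / 2"
        unfolding parallelogram[of y] using zero_le_power2[of "X y - Y y"] by linarith
      ultimately show ?thesis by (simp only: real_norm_def abs_of_nonneg)
    qed
    then show "AE y in ?Q. norm (?c y) \<le> norm ((?a y + ?b y) / 2)" by simp
  qed measurable
  have Wfin: "gen_variance S L \<theta> ?W < \<infinity>"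
    using c square_integrable_iff_finite_variance[OF WU \<theta>] by simp
  have ab: "(LINT y|?Q. ?a y) \<le> (LINT y|?Q. ?b y)" and bc: "(LINT y|?Q. ?b y) \<le> (LINT y|?Q. ?c y)"
    using XY YW by (auto simp: gen_variance_eq_integral[OF XU \<theta> Xfin] gen_variance_eq_integral[OF YU \<theta> fin]
        gen_variance_eq_integral[OF WU \<theta> Wfin])
  have d: "(X y - Y y)\<^sup>2 = 2 * ?a y + 2 * ?b y - 4 * ?c y" for y
    by (simp add: power2_eq_square field_simps)
  have d_int: "integrable ?Q (\<lambda>y. (X y - Y y)\<^sup>2)" 
    unfolding d using a b c by (intro Bochner_Integration.integrable_add Bochner_Integration.integrable_diff integrable_mult_right)
  have "(LINT y|?Q. (X y - Y y)\<^sup>2) = 2 * (LINT y|?Q. ?a y) + 2 * (LINT y|?Q. ?b y) - 4 * (LINT y|?Q. ?c y)"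
    unfolding d using a b c
    by (simp only: Bochner_Integration.integral_add Bochner_Integration.integral_diff
        Bochner_Integration.integrable_add integrable_mult_right integral_mult_right_zero)
  \<comment> \<open>With the three integrals in increasing order \<open>a \<le> b \<le> c\<close>,
    one has \<open>2 * a + 2 * b - 4 * c \<le> 4 * b - 4 * c \<le> 0\<close>.\<close>
  with ab bc have "(LINT y|?Q. (X y - Y y)\<^sup>2) \<le> 0" by simp
  moreover have "(LINT y|?Q. (X y - Y y)\<^sup>2) \<ge> 0" by simp
  ultimately have "AE y in ?Q. (X y - Y y)\<^sup>2 = 0"
    using integral_nonneg_eq_0_iff_AE[OF d_int] by simp
  then show ?thesis by (simp add: AE_deformed \<theta>)
qed

text \<open>Conditioning a competitor on \<open>T\<close> gives some \<open>g (T y)\<close> of no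
  larger variance, and completeness identifies it almost everywhere with
  \<open>h (T y)\<close>.\<close>

lemma unbiased_function_of_T_UMVUE:
  assumes h: "generalized_unbiased S \<Lambda> L \<tau> (\<lambda>y. h (T y))"
  shows "generalized_UMVUE S \<Lambda> L \<tau> (\<lambda>y. h (T y))"
  unfolding generalized_UMVUE_def
proof (intro conjI allI impI ballI h)
  fix X \<theta> assume X: "generalized_unbiased S \<Lambda> L \<tau> X" and \<theta>: "\<theta> \<in> \<Lambda>"
  obtain g where g: "generalized_unbiased S \<Lambda> L \<tau> (\<lambda>y. g (T y))"
    and le: "gen_variance S L \<theta> (\<lambda>y. g (T y)) \<le> gen_variance S L \<theta> X"
    using rao_blackwell[OF X] \<theta> by blast
  have "AE y in deformed S L \<theta>. h (T y) = g (T y)"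
    using unbiased_functions_of_T_unique[OF h g] by (simp add: AE_deformed \<theta>)
  then have "gen_variance S L \<theta> (\<lambda>y. h (T y)) = gen_variance S L \<theta> (\<lambda>y. g (T y))"
    unfolding gen_variance_unbiased[OF h \<theta>] gen_variance_unbiased[OF g \<theta>]
    by (intro nn_integral_cong_AE) auto
  with le show "gen_variance S L \<theta> (\<lambda>y. h (T y)) \<le> gen_variance S L \<theta> X" by simp
qed

end

section \<open>The Lehmann-Scheffe theorem for deformed laws\<close>

theorem theorem3p1:
  fixes S :: "real set"
    and \<Lambda> :: "(real ^ 'k) set"
    and f :: "real ^ 'k \<Rightarrow> real \<Rightarrow> real"
    and L :: "real ^ 'n \<Rightarrow> real ^ 'k \<Rightarrow> real"
    and T :: "real ^ 'n \<Rightarrow> 't::euclidean_space"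
    and \<tau> :: "real ^ 'k \<Rightarrow> real"
  assumes "generalized_likelihood_model S \<Lambda> f L"
    and "T \<in> borel_measurable (sample_lborel S)"
    and "generalized_sufficient S \<Lambda> L T"
    and "generalized_complete S \<Lambda> L T"
    and "generalized_estimable S \<Lambda> L \<tau>"
  shows "\<exists>h :: 't \<Rightarrow> real. h \<in> borel_measurable borel \<and>
      generalized_unbiased S \<Lambda> L \<tau> (\<lambda>y. h (T y)) \<and>
      (\<forall>h' :: 't \<Rightarrow> real. generalized_unbiased S \<Lambda> L \<tau> (\<lambda>y. h' (T y)) \<longrightarrow>
         deformed_as_equal S \<Lambda> L (\<lambda>y. h' (T y)) (\<lambda>y. h (T y))) \<and>
      generalized_UMVUE S \<Lambda> L \<tau> (\<lambda>y. h (T y)) \<and>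
      ((\<exists>\<theta>\<in>\<Lambda>. gen_variance S L \<theta> (\<lambda>y. h (T y)) < \<infinity>) \<longrightarrow>
         (\<forall>X. generalized_UMVUE S \<Lambda> L \<tau> X \<longrightarrow> deformed_as_equal S \<Lambda> L X (\<lambda>y. h (T y))))"
proof (cases "\<Lambda> = {}")
  \<comment> \<open>Without parameters there is no reference law, but all claims over parameters are
    vacuous and any Borel \<open>h\<close> serves.\<close>
  case True
  then show ?thesis
    by (intro exI[of _ "\<lambda>_. 0"])
      (simp add: generalized_unbiased_def deformed_as_equal_def generalized_UMVUE_def)
next
  case False
  then obtain \<theta>\<^sub>0 where "\<theta>\<^sub>0 \<in> \<Lambda>" by blast
  with assms interpret complete_sufficient_model S \<Lambda> f L T \<theta>\<^sub>0
    by (simp add: complete_sufficient_model_def complete_sufficient_model_axioms_def)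
  obtain X where "generalized_unbiased S \<Lambda> L \<tau> X"
    using assms(5) by (auto simp: generalized_estimable_def)
  then obtain h where h: "h \<in> borel_measurable borel" "generalized_unbiased S \<Lambda> L \<tau> (\<lambda>y. h (T y))"
    using rao_blackwell by blast
  have UMVUE: "generalized_UMVUE S \<Lambda> L \<tau> (\<lambda>y. h (T y))"
    using h(2) by (rule unbiased_function_of_T_UMVUE)
  have "deformed_as_equal S \<Lambda> L (\<lambda>y. h' (T y)) (\<lambda>y. h (T y))"
    if "generalized_unbiased S \<Lambda> L \<tau> (\<lambda>y. h' (T y))" for h'
    using unbiased_functions_of_T_unique[OF that h(2)] by (simp add: deformed_as_equal_iff[OF that h(2)])
  \<comment> \<open>Finite variance at a single parameter suffices: it gives equality almost
    everywhere for \<open>\<mu>\<close>, which passes to every deformed law.\<close>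
  moreover have "deformed_as_equal S \<Lambda> L Y (\<lambda>y. h (T y))"
    if "generalized_UMVUE S \<Lambda> L \<tau> Y" "\<theta> \<in> \<Lambda>" "gen_variance S L \<theta> (\<lambda>y. h (T y)) < \<infinity>" for Y \<theta>
  proof -
    have "generalized_unbiased S \<Lambda> L \<tau> Y" using that(1) by (simp add: generalized_UMVUE_def)
    then show ?thesis
      using UMVUE_unique[OF UMVUE that] by (simp add: deformed_as_equal_iff[OF _ h(2)])
  qed
  ultimately show ?thesis using h UMVUE by blast
qed

end
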